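(* Let $b$ be any locally integrable function on $\mathbb{R}^n$. Then the inequality $$|[M,b]f(x)|\le C_b(f)(x)+2b^-(x)\,Mf(x)\qquad (x\in\mathbb{R}^n)$$ holds for all functions $f\in L_1^{\mathrm{loc}}(\mathbb{R}^n)$.
   Context: $L_1^{\mathrm{loc}}(\mathbb{R}^n)$ is the set of locally integrable functions on $\mathbb{R}^n$. Cubes in $\mathbb{R}^n$ have sides parallel to the coordinate axes. The Hardy–Littlewood maximal function is $Mf(x)=\sup_{Q\ni x}\frac1{|Q|}\int_Q|f(y)|\,dy$, the supremum being over all cubes $Q$ containing $x$. The maximal commutator is $C_b(f)(x)=\sup_{Q\ni x}\frac1{|Q|}\int_Q|b(x)-b(y)||f(y)|\,dy$, the supremum being over all cubes $Q$ containing $x$. $b^-(x)=-\min\{b(x),0\}$. The commutator of $M$ and $b$ is $[M,b]f(x)=M(bf)(x)-b(x)Mf(x)$.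
   Formalization: The inequality is asserted only at points x where M(bf)(x) and b(x)Mf(x) are not both +∞, since otherwise [M,b]f(x) is the undefined ∞ − ∞ (e.g. b = 1, f(y) = |y|, at every x); elsewhere it holds in the extended reals with 0·∞ = 0. *)

theory Defs
  imports "HOL-Analysis.Analysis"
begin

definition locally_integrable :: "(real ^ 'n \<Rightarrow> real) \<Rightarrow> bool" where
  "locally_integrable f \<longleftrightarrow> (\<forall>K. compact K \<longrightarrow> f absolutely_integrable_on K)"

(* Cubes are closed and nondegenerate: the vector below is the corner opposite to a
   in a cube of side length l. *)
definition is_cube :: "(real ^ 'n) set \<Rightarrow> bool" where
  "is_cube Q \<longleftrightarrow> (\<exists>a l. l > 0 \<and> Q = cbox a (\<chi> i. a $ i + l))"

(* The maximal operators are suprema of averages of nonnegative functions and may be infinite,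
   so they take values in [0, infinity].  In particular maximal_fun (b * f) makes sense even
   when b * f is not locally integrable. *)
definition maximal_fun :: "(real ^ 'n \<Rightarrow> real) \<Rightarrow> real ^ 'n \<Rightarrow> ennreal" where
  "maximal_fun f x =
     (SUP Q \<in> {Q. is_cube Q \<and> x \<in> Q}.
        (\<integral>\<^sup>+y\<in>Q. ennreal \<bar>f y\<bar> \<partial>lebesgue) / emeasure lebesgue Q)"

definition maximal_commutator ::
    "(real ^ 'n \<Rightarrow> real) \<Rightarrow> (real ^ 'n \<Rightarrow> real) \<Rightarrow> real ^ 'n \<Rightarrow> ennreal" where
  "maximal_commutator b f x =
     (SUP Q \<in> {Q. is_cube Q \<and> x \<in> Q}.
        (\<integral>\<^sup>+y\<in>Q. ennreal (\<bar>b x - b y\<bar> * \<bar>f y\<bar>) \<partial>lebesgue) / emeasure lebesgue Q)"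

definition neg_part :: "(real ^ 'n \<Rightarrow> real) \<Rightarrow> real ^ 'n \<Rightarrow> real" where
  "neg_part b x = - min (b x) 0"

(* The difference M(bf)(x) - b(x) Mf(x) is meaningless when it has the form
   infinity - infinity; this predicate describes the remaining points.  (The subtraction of
   ereal assigns the arbitrary value infinity in the excluded case.)  Here 0 * infinity = 0. *)
definition commutator_defined_at ::
    "(real ^ 'n \<Rightarrow> real) \<Rightarrow> (real ^ 'n \<Rightarrow> real) \<Rightarrow> real ^ 'n \<Rightarrow> bool" where
  "commutator_defined_at b f x \<longleftrightarrow>
     \<not> (enn2ereal (maximal_fun (\<lambda>y. b y * f y) x) = \<infinity> \<and>
        ereal (b x) * enn2ereal (maximal_fun f x) = \<infinity>)"

definition commutator_maximal ::
    "(real ^ 'n \<Rightarrow> real) \<Rightarrow> (real ^ 'n \<Rightarrow> real) \<Rightarrow> real ^ 'n \<Rightarrow> ereal" where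
  "commutator_maximal b f x =
     enn2ereal (maximal_fun (\<lambda>y. b y * f y) x) - ereal (b x) * enn2ereal (maximal_fun f x)"

end

theory Submission
  imports Defs
begin

text \<open>On every cube the averages satisfy the triangle inequality, so with values in
  \<open>[0, \<infinity>]\<close> one has \<open>M(bf)(x) \<le> C\<^sub>b(f)(x) + |b(x)| Mf(x)\<close> and
  \<open>|b(x)| Mf(x) \<le> C\<^sub>b(f)(x) + M(bf)(x)\<close>. For \<open>b(x) \<ge> 0\<close> these two bounds are the claim;
  for \<open>b(x) < 0\<close> the commutator is \<open>M(bf)(x) + |b(x)| Mf(x)\<close> and the first bound suffices.\<close>

text \<open>The truncations to balls of integer radius are integrable, hence measurable, and
  converge pointwise. Measurability is what makes the integrals on cubes additive.\<close>

lemma locally_integrable_imp_borel_measurable: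
  fixes f :: "real ^ 'n \<Rightarrow> real"
  assumes "locally_integrable f"
  shows "f \<in> borel_measurable lebesgue"
proof (rule borel_measurable_LIMSEQ_metric)
  fix k :: nat
  have "set_integrable lebesgue (cball 0 (real k)) f"
    using assms by (simp add: locally_integrable_def)
  then show "(\<lambda>y. indicator (cball 0 (real k)) y *\<^sub>R f y) \<in> borel_measurable lebesgue"
    unfolding set_integrable_def by (rule borel_measurable_integrable)
next
  fix y :: "real ^ 'n"
  obtain N :: nat where N: "norm y \<le> real N"
    using real_arch_simple by blast
  \<comment> \<open>Once \<open>k\<close> reaches \<open>N\<close>, the ball contains
    \<open>y\<close> and the truncation no longer changes the value.\<close>
  have "\<forall>\<^sub>F k in sequentially. indicator (cball 0 (real k)) y *\<^sub>R f y = f y"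
    using eventually_ge_at_top[of N] by eventually_elim (use N in auto)
  then show "(\<lambda>k. indicator (cball 0 (real k)) y *\<^sub>R f y) \<longlonglongrightarrow> f y"
    by (rule tendsto_eventually)
qed

lemma is_cube_in_sets_lebesgue: "is_cube Q \<Longrightarrow> Q \<in> sets lebesgue"
  by (auto simp: is_cube_def)

lemma set_nn_integral_average_le:
  fixes g h k :: "'a \<Rightarrow> ennreal"
  assumes "g \<in> borel_measurable M" "h \<in> borel_measurable M" "Q \<in> sets M"
    and "\<And>y. k y \<le> g y + h y"
  shows "(\<integral>\<^sup>+y\<in>Q. k y \<partial>M) / c \<le> (\<integral>\<^sup>+y\<in>Q. g y \<partial>M) / c + (\<integral>\<^sup>+y\<in>Q. h y \<partial>M) / c"
proof -
  have "(\<integral>\<^sup>+y\<in>Q. k y \<partial>M) \<le> (\<integral>\<^sup>+y. g y * indicator Q y + h y * indicator Q y \<partial>M)"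
    using assms(4) by (intro nn_integral_mono) (auto simp: indicator_def)
  also have "\<dots> = (\<integral>\<^sup>+y\<in>Q. g y \<partial>M) + (\<integral>\<^sup>+y\<in>Q. h y \<partial>M)"
    using assms by (intro nn_integral_add) auto
  finally show ?thesis
    by (metis add_divide_distrib_ennreal divide_right_mono_ennreal)
qed

lemma maximal_fun_mult_left:
  fixes f :: "real ^ 'n \<Rightarrow> real"
  assumes "f \<in> borel_measurable lebesgue"
  shows "maximal_fun (\<lambda>y. c * f y) x = ennreal \<bar>c\<bar> * maximal_fun f x"
  unfolding maximal_fun_def SUP_mult_left_ennreal
proof (rule SUP_cong[OF refl])
  fix Q :: "(real ^ 'n) set" assume "Q \<in> {Q. is_cube Q \<and> x \<in> Q}"
  then have "Q \<in> sets lebesgue"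
    by (simp add: is_cube_in_sets_lebesgue)
  then have "(\<integral>\<^sup>+y. ennreal \<bar>c\<bar> * (ennreal \<bar>f y\<bar> * indicator Q y) \<partial>lebesgue)
      = ennreal \<bar>c\<bar> * (\<integral>\<^sup>+y\<in>Q. ennreal \<bar>f y\<bar> \<partial>lebesgue)"
    using assms by (intro nn_integral_cmult) auto
  then show "(\<integral>\<^sup>+y\<in>Q. ennreal \<bar>c * f y\<bar> \<partial>lebesgue) / emeasure lebesgue Q
      = ennreal \<bar>c\<bar> * ((\<integral>\<^sup>+y\<in>Q. ennreal \<bar>f y\<bar> \<partial>lebesgue) / emeasure lebesgue Q)"
    by (simp add: abs_mult ennreal_mult mult.assoc ennreal_times_divide)
qed

text \<open>Common core of both bounds: \<open>g\<close> and \<open>h\<close> will be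
  \<open>b y * f y\<close> and \<open>b x * f y\<close>, in either order. On each cube the averages
  add, and each is below its own supremum.\<close>

lemma maximal_fun_le_maximal_commutator_plus:
  assumes [measurable]: "b \<in> borel_measurable lebesgue" "f \<in> borel_measurable lebesgue"
      "h \<in> borel_measurable lebesgue"
    and le: "\<And>y. \<bar>g y\<bar> \<le> \<bar>b x - b y\<bar> * \<bar>f y\<bar> + \<bar>h y\<bar>"
  shows "maximal_fun g x \<le> maximal_commutator b f x + maximal_fun h x"
  unfolding maximal_fun_def[of g]
proof (rule SUP_least)
  fix Q assume Q: "Q \<in> {Q. is_cube Q \<and> x \<in> Q}"
  have "ennreal \<bar>g y\<bar> \<le> ennreal (\<bar>b x - b y\<bar> * \<bar>f y\<bar>) + ennreal \<bar>h y\<bar>" for y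
    using le[of y] by (simp flip: ennreal_plus)
  then have "(\<integral>\<^sup>+y\<in>Q. ennreal \<bar>g y\<bar> \<partial>lebesgue) / emeasure lebesgue Q
      \<le> (\<integral>\<^sup>+y\<in>Q. ennreal (\<bar>b x - b y\<bar> * \<bar>f y\<bar>) \<partial>lebesgue) / emeasure lebesgue Q
        + (\<integral>\<^sup>+y\<in>Q. ennreal \<bar>h y\<bar> \<partial>lebesgue) / emeasure lebesgue Q"
    using Q by (intro set_nn_integral_average_le) (auto simp: is_cube_in_sets_lebesgue)
  also have "\<dots> \<le> maximal_commutator b f x + maximal_fun h x"
    unfolding maximal_fun_def maximal_commutator_def by (intro add_mono SUP_upper Q)
  finally show "(\<integral>\<^sup>+y\<in>Q. ennreal \<bar>g y\<bar> \<partial>lebesgue) / emeasure lebesgue Q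
      \<le> maximal_commutator b f x + maximal_fun h x" .
qed

lemma maximal_fun_mult_le:
  assumes [measurable]: "b \<in> borel_measurable lebesgue" "f \<in> borel_measurable lebesgue"
  shows "maximal_fun (\<lambda>y. b y * f y) x \<le> maximal_commutator b f x + ennreal \<bar>b x\<bar> * maximal_fun f x"
proof -
  have "\<bar>b y * f y\<bar> \<le> \<bar>b x - b y\<bar> * \<bar>f y\<bar> + \<bar>b x * f y\<bar>" for y
    \<comment> \<open>With \<open>\<bar>f y\<bar>\<close> factored out, this is the triangle
      inequality for \<open>b y = b x - (b x - b y)\<close>.\<close>
    unfolding abs_mult distrib_right[symmetric] by (intro mult_right_mono) auto
  then have "maximal_fun (\<lambda>y. b y * f y) x
      \<le> maximal_commutator b f x + maximal_fun (\<lambda>y. b x * f y) x"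
    by (intro maximal_fun_le_maximal_commutator_plus) auto
  then show ?thesis
    by (simp add: maximal_fun_mult_left)
qed

lemma mult_maximal_fun_le:
  assumes [measurable]: "b \<in> borel_measurable lebesgue" "f \<in> borel_measurable lebesgue"
  shows "ennreal \<bar>b x\<bar> * maximal_fun f x \<le> maximal_commutator b f x + maximal_fun (\<lambda>y. b y * f y) x"
proof -
  have "\<bar>b x * f y\<bar> \<le> \<bar>b x - b y\<bar> * \<bar>f y\<bar> + \<bar>b y * f y\<bar>" for y
    unfolding abs_mult distrib_right[symmetric] by (intro mult_right_mono) auto
  then have "maximal_fun (\<lambda>y. b x * f y) x
      \<le> maximal_commutator b f x + maximal_fun (\<lambda>y. b y * f y) x"
    by (intro maximal_fun_le_maximal_commutator_plus) auto
  then show ?thesis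
    by (simp add: maximal_fun_mult_left)
qed

text \<open>The last hypothesis matters: in \<open>ereal\<close> the difference of two infinities is
  infinite, while the other hypotheses then hold even for \<open>c = 0\<close>.\<close>

lemma ereal_abs_diff_le:
  fixes a c d :: ereal
  assumes "0 \<le> a" "0 \<le> d" "a \<le> c + d" "d \<le> c + a" "\<not> (a = \<infinity> \<and> d = \<infinity>)"
  shows "\<bar>a - d\<bar> \<le> c"
  using assms by (cases a; cases c; cases d) auto

theorem lemma5p2:
  fixes b f :: "real ^ 'n \<Rightarrow> real" and x :: "real ^ 'n"
  assumes "locally_integrable b"
    and "locally_integrable f"
    and "commutator_defined_at b f x"
  shows "\<bar>commutator_maximal b f x\<bar>
           \<le> enn2ereal (maximal_commutator b f x)
              + 2 * ereal (neg_part b x) * enn2ereal (maximal_fun f x)"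
proof -
  define A C F where "A = enn2ereal (maximal_fun (\<lambda>y. b y * f y) x)"
    and "C = enn2ereal (maximal_commutator b f x)" and "F = enn2ereal (maximal_fun f x)"
  note meas = assms(1,2)[THEN locally_integrable_imp_borel_measurable]
  have nonneg: "0 \<le> A" "0 \<le> C" "0 \<le> F"
    by (simp_all add: A_def C_def F_def)
  \<comment> \<open>Both bounds move from \<open>ennreal\<close> to \<open>ereal\<close>, where
    subtraction and a negative \<open>b x\<close> make sense.\<close>
  have upper: "A \<le> C + ereal \<bar>b x\<bar> * F"
    using maximal_fun_mult_le[OF meas, of x]
    by (simp add: A_def C_def F_def less_eq_ennreal.rep_eq plus_ennreal.rep_eq times_ennreal.rep_eq)
  have lower: "ereal \<bar>b x\<bar> * F \<le> C + A"
    using mult_maximal_fun_le[OF meas, of x]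
    by (simp add: A_def C_def F_def less_eq_ennreal.rep_eq plus_ennreal.rep_eq times_ennreal.rep_eq)
  have "\<bar>A - ereal (b x) * F\<bar> \<le> C + 2 * ereal (neg_part b x) * F"
  proof (cases "0 \<le> b x")
    case True
    then have "\<bar>A - ereal (b x) * F\<bar> \<le> C"
      using nonneg upper lower assms(3)
      by (intro ereal_abs_diff_le) (auto simp: A_def F_def commutator_defined_at_def)
    \<comment> \<open>The negative part is zero here, and its product with \<open>F\<close> vanishes
      even for infinite \<open>F\<close>.\<close>
    with True show ?thesis
      by (simp add: neg_part_def flip: zero_ereal_def)
  next
    case False
    let ?D = "ereal \<bar>b x\<bar> * F"
    have D: "0 \<le> ?D"
      using nonneg by simp
    have "ereal (b x) = - ereal \<bar>b x\<bar>"
      using False by simp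
    then have "ereal (b x) * F = - ?D"
      by (simp only: ereal_mult_minus_left)
    then have "\<bar>A - ereal (b x) * F\<bar> = A + ?D"
      using D nonneg by (simp add: minus_ereal_def)
    also have "\<dots> \<le> C + ?D + ?D"
      using upper by (rule add_right_mono)
    also have "\<dots> = C + 2 * ereal (neg_part b x) * F"
    proof -
      have "ereal (neg_part b x) = ereal \<bar>b x\<bar>"
        using False by (simp add: neg_part_def)
      \<comment> \<open>One \<open>?D\<close> comes from the commutator, the other from
        \<open>upper\<close>; the case split covers infinite \<open>?D\<close>.\<close>
      moreover have "?D + ?D = 2 * ?D"
        by (cases "?D") auto
      ultimately show ?thesis
        by (simp only: add.assoc mult.assoc)
    qed
    finally show ?thesis .
  qed
  then show ?thesis
    by (simp add: commutator_maximal_def A_def C_def F_def)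
qed

end
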